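(* Let $(\Omega,\mathcal{A},\mu)$ be a complete $\sigma$-finite measure space, let $E$ be a Köthe function space over $(\Omega,\mathcal{A},\mu)$, and let $X$ be a real Banach space such that the simple functions are dense in the Köthe–Bochner space $E(X)$. If $E(X)$ has the Ball Dentable Property ($BDP$), then $X$ has $BDP$.
   Context: For a real Banach space $X$, $B_X$ denotes its closed unit ball and $X^*$ its dual. A slice of a bounded set $C\subseteq X$ is $S(C,x^*,\alpha)=\{x\in C: x^*(x)>\sup x^*(C)-\alpha\}$ with $x^*\in X^*$, $\|x^*\|=1$, $\alpha>0$. $X$ has the Ball Dentable Property ($BDP$) if for every $\varepsilon>0$ there is a slice of $B_X$ of diameter less than $\varepsilon$. A Köthe function space over a complete $\sigma$-finite measure space $(\Omega,\mathcal{A},\mu)$ is a Banach space $(E,\|\cdot\|_E)$ of real-valued measurable functions on $\Omega$ (modulo equality $\mu$-a.e.) such that: (1) $\chi_A\in E$ for all $A\in\mathcal{A}$ with $\mu(A)<\infty$; (2) every $f\in E$ is $\mu$-integrable over every $A\in\mathcal{A}$ with $\mu(A)<\infty$; (3) if $g$ is measurable, $f\in E$ and $|g|\le|f|$ $\mu$-a.e., then $g\in E$ and $\|g\|_E\le\|f\|_E$. A function $f:\Omega\to X$ is simple if $f=\sum_{i=1}^n x_i\chi_{A_i}$ with $A_i\in\mathcal{A}$ pairwise disjoint, $\mu(A_i)<\infty$, and $x_i\in X\setminus\{0\}$; $f$ is Bochner measurable if it is the $\mu$-a.e. pointwise norm limit of a sequence of simple functions. The Köthe–Bochner space is $E(X)=\{f:\Omega\to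 X \text{ Bochner measurable}: \|f(\cdot)\|\in E\}$ with norm $\|f\|_{E(X)}=\big\|\,\|f(\cdot)\|\,\big\|_E$. *)

theory Defs
  imports "HOL-Analysis.Analysis"
begin

section \<open>Ball Dentable Property for a seminormed real vector space\<close>

text \<open>A (semi)normed real vector space is given by a carrier set S inside some type,
  explicit vector operations add and sc (scalar multiplication) and a seminorm p.
  Elements of seminorm zero are identified with 0 (quotient); all notions below are
  invariant under this identification.\<close>

definition is_dual_functional ::
  "('v \<Rightarrow> 'v \<Rightarrow> 'v) \<Rightarrow> (real \<Rightarrow> 'v \<Rightarrow> 'v) \<Rightarrow> 'v set \<Rightarrow> ('v \<Rightarrow> real) \<Rightarrow> ('v \<Rightarrow> real) \<Rightarrow> bool" where
  "is_dual_functional add sc S p \<phi> \<longleftrightarrow>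
     (\<forall>x\<in>S. \<forall>y\<in>S. \<forall>a b. \<phi> (add (sc a x) (sc b y)) = a * \<phi> x + b * \<phi> y) \<and>
     (\<exists>C. \<forall>x\<in>S. \<bar>\<phi> x\<bar> \<le> C * p x)"

definition unit_ball_sn :: "'v set \<Rightarrow> ('v \<Rightarrow> real) \<Rightarrow> 'v set" where
  "unit_ball_sn S p = {x\<in>S. p x \<le> 1}"

definition dual_norm_sn :: "'v set \<Rightarrow> ('v \<Rightarrow> real) \<Rightarrow> ('v \<Rightarrow> real) \<Rightarrow> real" where
  "dual_norm_sn S p \<phi> = Sup ((\<lambda>x. \<bar>\<phi> x\<bar>) ` unit_ball_sn S p)"

definition slice_sn :: "'v set \<Rightarrow> ('v \<Rightarrow> real) \<Rightarrow> real \<Rightarrow> 'v set" where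
  "slice_sn C \<phi> \<alpha> = {x\<in>C. \<phi> x > Sup (\<phi> ` C) - \<alpha>}"

definition diam_sn :: "('v \<Rightarrow> 'v \<Rightarrow> 'v) \<Rightarrow> (real \<Rightarrow> 'v \<Rightarrow> 'v) \<Rightarrow> ('v \<Rightarrow> real) \<Rightarrow> 'v set \<Rightarrow> real" where
  "diam_sn add sc p A = Sup {p (add x (sc (-1) y)) | x y. x \<in> A \<and> y \<in> A}"

definition BDP_sn ::
  "('v \<Rightarrow> 'v \<Rightarrow> 'v) \<Rightarrow> (real \<Rightarrow> 'v \<Rightarrow> 'v) \<Rightarrow> 'v set \<Rightarrow> ('v \<Rightarrow> real) \<Rightarrow> bool" where
  "BDP_sn add sc S p \<longleftrightarrow>
     (\<forall>\<epsilon>>0. \<exists>\<phi> \<alpha>. is_dual_functional add sc S p \<phi> \<and> dual_norm_sn S p \<phi> = 1 \<and> \<alpha> > 0 \<and>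
        diam_sn add sc p (slice_sn (unit_ball_sn S p) \<phi> \<alpha>) < \<epsilon>)"

text \<open>BDP for a real Banach space X (a type of class banach).\<close>
definition BDP :: "'x::real_normed_vector itself \<Rightarrow> bool" where
  "BDP _ \<longleftrightarrow> BDP_sn ((+) :: 'x \<Rightarrow> 'x \<Rightarrow> 'x) (*\<^sub>R) UNIV norm"

section \<open>Koethe function spaces\<close>

text \<open>E is a set of real functions on the measure space M, N its (semi)norm; the Banach
  space is E modulo equality a.e.\<close>
definition kothe_space :: "'a measure \<Rightarrow> ('a \<Rightarrow> real) set \<Rightarrow> (('a \<Rightarrow> real) \<Rightarrow> real) \<Rightarrow> bool" where
  "kothe_space M E N \<longleftrightarrow>
     \<comment> \<open>measurable functions, linear subspace\<close>
     E \<subseteq> borel_measurable M \<and>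
     (\<lambda>_. 0) \<in> E \<and>
     (\<forall>f\<in>E. \<forall>g\<in>E. (\<lambda>x. f x + g x) \<in> E) \<and>
     (\<forall>f\<in>E. \<forall>c. (\<lambda>x. c * f x) \<in> E) \<and>
     \<comment> \<open>N is a norm on E modulo a.e. equality\<close>
     (\<forall>f\<in>E. N f \<ge> 0) \<and>
     (\<forall>f\<in>E. \<forall>g\<in>E. N (\<lambda>x. f x + g x) \<le> N f + N g) \<and>
     (\<forall>f\<in>E. \<forall>c. N (\<lambda>x. c * f x) = \<bar>c\<bar> * N f) \<and>
     (\<forall>f\<in>E. N f = 0 \<longleftrightarrow> (AE x in M. f x = 0)) \<and>
     \<comment> \<open>completeness (Banach space)\<close>
     (\<forall>F. (\<forall>n. F n \<in> E) \<longrightarrow>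
          (\<forall>e>0. \<exists>K. \<forall>m\<ge>K. \<forall>n\<ge>K. N (\<lambda>x. F m x - F n x) < e) \<longrightarrow>
          (\<exists>f\<in>E. (\<lambda>n. N (\<lambda>x. F n x - f x)) \<longlonglongrightarrow> 0)) \<and>
     \<comment> \<open>(1) characteristic functions of sets of finite measure\<close>
     (\<forall>A\<in>sets M. emeasure M A < \<infinity> \<longrightarrow> indicator A \<in> E) \<and>
     \<comment> \<open>(2) local integrability\<close>
     (\<forall>f\<in>E. \<forall>A\<in>sets M. emeasure M A < \<infinity> \<longrightarrow> set_integrable M A f) \<and>
     \<comment> \<open>(3) ideal property / lattice norm\<close>
     (\<forall>f\<in>E. \<forall>g\<in>borel_measurable M. (AE x in M. \<bar>g x\<bar> \<le> \<bar>f x\<bar>) \<longrightarrow> g \<in> E \<and> N g \<le> N f)"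

section \<open>Koethe-Bochner spaces\<close>

definition simple_fun_X :: "'a measure \<Rightarrow> ('a \<Rightarrow> 'x::real_normed_vector) \<Rightarrow> bool" where
  "simple_fun_X M s \<longleftrightarrow>
     (\<exists>n::nat. \<exists>A :: nat \<Rightarrow> 'a set. \<exists>v :: nat \<Rightarrow> 'x.
        (\<forall>i<n. A i \<in> sets M \<and> emeasure M (A i) < \<infinity> \<and> v i \<noteq> 0) \<and>
        disjoint_family_on A {..<n} \<and>
        s = (\<lambda>\<omega>. \<Sum>i<n. indicator (A i) \<omega> *\<^sub>R v i))"

definition bochner_measurable :: "'a measure \<Rightarrow> ('a \<Rightarrow> 'x::real_normed_vector) \<Rightarrow> bool" where
  "bochner_measurable M f \<longleftrightarrow>
     (\<exists>s :: nat \<Rightarrow> 'a \<Rightarrow> 'x. (\<forall>n. simple_fun_X M (s n)) \<and>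
        (AE \<omega> in M. (\<lambda>n. s n \<omega>) \<longlonglongrightarrow> f \<omega>))"

definition kothe_bochner :: "'a measure \<Rightarrow> ('a \<Rightarrow> real) set \<Rightarrow> ('a \<Rightarrow> 'x::real_normed_vector) set" where
  "kothe_bochner M E = {f. bochner_measurable M f \<and> (\<lambda>\<omega>. norm (f \<omega>)) \<in> E}"

definition kb_norm :: "(('a \<Rightarrow> real) \<Rightarrow> real) \<Rightarrow> ('a \<Rightarrow> 'x::real_normed_vector) \<Rightarrow> real" where
  "kb_norm N f = N (\<lambda>\<omega>. norm (f \<omega>))"

definition fun_add :: "('a \<Rightarrow> 'x::real_vector) \<Rightarrow> ('a \<Rightarrow> 'x) \<Rightarrow> 'a \<Rightarrow> 'x" where
  "fun_add f g = (\<lambda>\<omega>. f \<omega> + g \<omega>)"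

definition fun_scale :: "real \<Rightarrow> ('a \<Rightarrow> 'x::real_vector) \<Rightarrow> 'a \<Rightarrow> 'x" where
  "fun_scale c f = (\<lambda>\<omega>. c *\<^sub>R f \<omega>)"

definition BDP_kothe_bochner :: "'a measure \<Rightarrow> ('a \<Rightarrow> real) set \<Rightarrow> (('a \<Rightarrow> real) \<Rightarrow> real) \<Rightarrow> 'x::real_normed_vector itself \<Rightarrow> bool" where
  "BDP_kothe_bochner M E N _ \<longleftrightarrow>
     BDP_sn fun_add fun_scale (kothe_bochner M E :: ('a \<Rightarrow> 'x) set) (kb_norm N)"

definition simple_dense :: "'a measure \<Rightarrow> ('a \<Rightarrow> real) set \<Rightarrow> (('a \<Rightarrow> real) \<Rightarrow> real) \<Rightarrow> 'x::real_normed_vector itself \<Rightarrow> bool" where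
  "simple_dense M E N _ \<longleftrightarrow>
     (\<forall>f \<in> (kothe_bochner M E :: ('a \<Rightarrow> 'x) set). \<forall>e>0. \<exists>s. simple_fun_X M s \<and>
        s \<in> kothe_bochner M E \<and> kb_norm N (\<lambda>\<omega>. f \<omega> - s \<omega>) < e)"

end

theory Submission
  imports Defs
begin

text \<open>
  Contrapositive: suppose every slice of the unit ball of X has diameter at least \<open>\<epsilon>\<close>, and put
  \<open>c = min (\<epsilon>/2) 2\<close>. Density of simple functions puts a step function
  \<open>s = \<Sum>\<^sub>i 1_(A i) v i\<close> with \<open>\<parallel>s\<parallel> > 1/2\<close> into any given slice of the unit ball of E(X).
  Each \<open>x \<mapsto> \<phi> (1_(A i) x)\<close> is a bounded functional on X, so a thin slice of the ball of
  radius \<open>\<parallel>v i\<parallel>\<close> contains two points \<open>y i\<close>, \<open>z i\<close> at distance \<open>\<ge> c \<parallel>v i\<parallel>\<close>, both almost as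
  good as \<open>v i\<close> for this functional. The step functions with values \<open>y i\<close> and \<open>z i\<close> then lie in the
  same slice, and their difference dominates \<open>c \<parallel>s(\<omega>)\<parallel>\<close> pointwise; by the lattice property of
  the norm of E the slice has diameter at least \<open>c \<parallel>s\<parallel> > c/2\<close>.
\<close>

section \<open>Step functions\<close>

lemma sum_indicator_scaleR_disjoint:
  fixes v :: "'i \<Rightarrow> 'x::real_vector"
  assumes "disjoint_family_on A I" "finite I" "j \<in> I" "\<omega> \<in> A j"
  shows "(\<Sum>i\<in>I. indicator (A i) \<omega> *\<^sub>R v i) = v j"
proof -
  have "(\<Sum>i\<in>I. indicator (A i) \<omega> *\<^sub>R v i) = (\<Sum>i\<in>I. if i = j then v j else 0)"
    using assms by (intro sum.cong) (auto simp: disjoint_family_on_def indicator_def)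
  then show ?thesis
    using assms by simp
qed

lemma sum_indicator_scaleR_rel:
  fixes v :: "'i \<Rightarrow> 'x::real_vector" and w :: "'i \<Rightarrow> 'y::real_vector"
  assumes "disjoint_family_on A I" "finite I" "\<forall>i\<in>I. R (w i) (v i)" "R 0 0"
  shows "R (\<Sum>i\<in>I. indicator (A i) \<omega> *\<^sub>R w i) (\<Sum>i\<in>I. indicator (A i) \<omega> *\<^sub>R v i)"
proof (cases "\<exists>j\<in>I. \<omega> \<in> A j")
  case True
  then obtain j where "j \<in> I" "\<omega> \<in> A j"
    by blast
  then show ?thesis
    using assms sum_indicator_scaleR_disjoint[OF assms(1,2)] by metis
next
  case False
  then show ?thesis
    using assms(4) by (simp add: indicator_def)
qed

lemma simple_fun_X_imp_simple_bochner_integrable: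
  assumes "simple_fun_X M s"
  shows "Bochner_Integration.simple_bochner_integrable M s \<and> (\<forall>\<omega>. \<omega> \<notin> space M \<longrightarrow> s \<omega> = 0)"
proof -
  obtain n :: nat and A v where A: "\<forall>i<n. A i \<in> sets M \<and> emeasure M (A i) < \<infinity> \<and> v i \<noteq> 0"
    and s: "s = (\<lambda>\<omega>. \<Sum>i<n. indicator (A i) \<omega> *\<^sub>R v i)"
    using assms unfolding simple_fun_X_def by blast
  have zero_off: "s \<omega> = 0" if "\<forall>i<n. \<omega> \<notin> A i" for \<omega>
    unfolding s by (rule sum.neutral) (use that in auto)
  have "simple_function M s"
    unfolding s
  proof (intro simple_function_sum simple_function_compose2[where h="(*\<^sub>R)"])
    show "simple_function M (indicator (A i))" if "i \<in> {..<n}" for i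
      using A that by simp
  qed simp
  moreover have "emeasure M {\<omega>\<in>space M. s \<omega> \<noteq> 0} \<noteq> \<infinity>"
  proof -
    have "emeasure M {\<omega>\<in>space M. s \<omega> \<noteq> 0} \<le> emeasure M (\<Union>i<n. A i)"
    proof (rule emeasure_mono)
      show "{\<omega>\<in>space M. s \<omega> \<noteq> 0} \<subseteq> (\<Union>i<n. A i)"
        using zero_off by blast
      show "(\<Union>i<n. A i) \<in> sets M"
        using A by (intro sets.finite_UN) auto
    qed
    also have "\<dots> \<le> (\<Sum>i<n. emeasure M (A i))"
      using A by (intro emeasure_subadditive_finite) auto
    also have "\<dots> < \<infinity>"
      using A by (simp add: sum_Pinfty less_top)
    finally show ?thesis
      by simp
  qed
  moreover have "s \<omega> = 0" if "\<omega> \<notin> space M" for \<omega>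
  proof (rule zero_off, intro allI impI)
    show "\<omega> \<notin> A i" if "i < n" for i
      using A that \<open>\<omega> \<notin> space M\<close> sets.sets_into_space[of "A i" M] by blast
  qed
  ultimately show ?thesis
    by (simp add: Bochner_Integration.simple_bochner_integrable.simps)
qed

lemma simple_function_level_sets_representation:
  fixes s :: "'a \<Rightarrow> 'x::real_vector"
  assumes "simple_function M s" "\<And>\<omega>. \<omega> \<notin> space M \<Longrightarrow> s \<omega> = 0"
  shows "s \<omega> = (\<Sum>y\<in>s ` space M - {0}. indicator (s -` {y} \<inter> space M) \<omega> *\<^sub>R y)"
proof (cases "\<omega> \<in> space M \<and> s \<omega> \<noteq> 0")
  case True
  have "finite (s ` space M - {0})"
    using assms(1) unfolding simple_function_def by blast
  then show ?thesis
    using True by (subst sum_indicator_scaleR_disjoint[where j = "s \<omega>"]) (auto simp: disjoint_family_on_def)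
next
  case False
  then show ?thesis
    using assms(2) by (auto simp: indicator_def intro!: sum.neutral)
qed

lemma simple_bochner_integrable_imp_simple_fun_X:
  assumes "Bochner_Integration.simple_bochner_integrable M s" and outside: "\<And>\<omega>. \<omega> \<notin> space M \<Longrightarrow> s \<omega> = 0"
  shows "simple_fun_X M s"
proof -
  have sf: "simple_function M s" and fin: "emeasure M {\<omega>\<in>space M. s \<omega> \<noteq> 0} < \<infinity>"
    using assms(1) by (auto elim: Bochner_Integration.simple_bochner_integrable.cases simp: less_top)
  define V where "V = s ` space M - {0}"
  define L where "L y = s -` {y} \<inter> space M" for y
  have "finite V"
    using sf unfolding V_def simple_function_def by blast
  then obtain e where e: "bij_betw e {..<card V} V"
    using ex_bij_betw_nat_finite lessThan_atLeast0 by metis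
  have L_sets: "L y \<in> sets M" for y
    unfolding L_def using sf by (rule simple_functionD)
  have "{\<omega>\<in>space M. s \<omega> \<noteq> 0} = s -` (- {0}) \<inter> space M"
    by auto
  then have supp_sets: "{\<omega>\<in>space M. s \<omega> \<noteq> 0} \<in> sets M"
    using simple_functionD(2)[OF sf] by simp
  have L_fin: "emeasure M (L y) < \<infinity>" if "y \<in> V" for y
  proof -
    have "emeasure M (L y) \<le> emeasure M {\<omega>\<in>space M. s \<omega> \<noteq> 0}"
      using that supp_sets by (intro emeasure_mono) (auto simp: L_def V_def)
    then show ?thesis
      using fin by simp
  qed
  show "simple_fun_X M s"
    unfolding simple_fun_X_def
  proof (intro exI conjI)
    show "\<forall>i<card V. (L \<circ> e) i \<in> sets M \<and> emeasure M ((L \<circ> e) i) < \<infinity> \<and> e i \<noteq> 0"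
    proof (intro allI impI)
      fix i assume "i < card V"
      then have "e i \<in> V"
        using bij_betw_apply[OF e] by simp
      then show "(L \<circ> e) i \<in> sets M \<and> emeasure M ((L \<circ> e) i) < \<infinity> \<and> e i \<noteq> 0"
        using L_sets L_fin by (simp add: V_def)
    qed
    show "disjoint_family_on (L \<circ> e) {..<card V}"
      using e by (auto simp: disjoint_family_on_def L_def bij_betw_def inj_on_def)
    show "s = (\<lambda>\<omega>. \<Sum>i<card V. indicator ((L \<circ> e) i) \<omega> *\<^sub>R e i)"
    proof
      fix \<omega>
      have "s \<omega> = (\<Sum>y\<in>V. indicator (L y) \<omega> *\<^sub>R y)"
        unfolding V_def L_def by (rule simple_function_level_sets_representation[OF sf outside])
      also have "\<dots> = (\<Sum>i<card V. indicator ((L \<circ> e) i) \<omega> *\<^sub>R e i)"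
        using sum.reindex_bij_betw[OF e, of "\<lambda>y. indicator (L y) \<omega> *\<^sub>R y"] by simp
      finally show "s \<omega> = (\<Sum>i<card V. indicator ((L \<circ> e) i) \<omega> *\<^sub>R e i)" .
    qed
  qed
qed

lemma simple_fun_X_iff:
  "simple_fun_X M s \<longleftrightarrow> Bochner_Integration.simple_bochner_integrable M s \<and> (\<forall>\<omega>. \<omega> \<notin> space M \<longrightarrow> s \<omega> = 0)"
  using simple_fun_X_imp_simple_bochner_integrable simple_bochner_integrable_imp_simple_fun_X[of M s]
  by auto

lemma simple_fun_X_compose2:
  assumes "simple_fun_X M f" "simple_fun_X M g" "h 0 0 = 0"
  shows "simple_fun_X M (\<lambda>\<omega>. h (f \<omega>) (g \<omega>))"
  using assms simple_bochner_integrable_compose2[of h M f g] by (simp add: simple_fun_X_iff)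

lemma simple_fun_X_indicator_scaleR:
  assumes "A \<in> sets M" "emeasure M A < \<infinity>"
  shows "simple_fun_X M (\<lambda>\<omega>. indicator A \<omega> *\<^sub>R x)"
proof -
  have "simple_function M (\<lambda>\<omega>. indicator A \<omega> *\<^sub>R x)"
    using assms(1) by (intro simple_function_compose2[where h="(*\<^sub>R)"]) auto
  moreover have "emeasure M {\<omega>\<in>space M. indicator A \<omega> *\<^sub>R x \<noteq> 0} \<le> emeasure M A"
    using assms(1) by (intro emeasure_mono) (auto simp: indicator_def)
  moreover have "A \<subseteq> space M"
    using assms(1) by (rule sets.sets_into_space)
  ultimately show ?thesis
    using assms(2) by (auto simp: simple_fun_X_iff Bochner_Integration.simple_bochner_integrable.simps indicator_def)
qed

lemma simple_fun_X_zero: "simple_fun_X M (\<lambda>_. 0)"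
  unfolding simple_fun_X_def by (rule exI[of _ 0]) (auto simp: disjoint_family_on_def)

lemma borel_measurable_simple_fun_X: "simple_fun_X M s \<Longrightarrow> s \<in> borel_measurable M"
  by (auto simp: simple_fun_X_iff Bochner_Integration.simple_bochner_integrable.simps
      intro: borel_measurable_simple_function)

lemma bochner_measurable_simple_fun_X: "simple_fun_X M s \<Longrightarrow> bochner_measurable M s"
  unfolding bochner_measurable_def by (intro exI[of _ "\<lambda>_. s"]) simp

lemma bochner_measurable_add_scaleR:
  assumes "bochner_measurable M F" "bochner_measurable M G"
  shows "bochner_measurable M (\<lambda>\<omega>. F \<omega> + c *\<^sub>R G \<omega>)"
proof -
  obtain s where s: "\<And>n. simple_fun_X M (s n)" "AE \<omega> in M. (\<lambda>n. s n \<omega>) \<longlonglongrightarrow> F \<omega>"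
    using assms(1) unfolding bochner_measurable_def by blast
  obtain t where t: "\<And>n. simple_fun_X M (t n)" "AE \<omega> in M. (\<lambda>n. t n \<omega>) \<longlonglongrightarrow> G \<omega>"
    using assms(2) unfolding bochner_measurable_def by blast
  have "simple_fun_X M (\<lambda>\<omega>. s n \<omega> + c *\<^sub>R t n \<omega>)" for n
    using simple_fun_X_compose2[OF s(1) t(1), of "\<lambda>a b. a + c *\<^sub>R b"] by simp
  moreover have "AE \<omega> in M. (\<lambda>n. s n \<omega> + c *\<^sub>R t n \<omega>) \<longlonglongrightarrow> F \<omega> + c *\<^sub>R G \<omega>"
    using s(2) t(2) by eventually_elim (intro tendsto_intros)
  ultimately show ?thesis
    unfolding bochner_measurable_def by (intro exI[of _ "\<lambda>n \<omega>. s n \<omega> + c *\<^sub>R t n \<omega>"]) blast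
qed

lemma (in complete_measure) borel_measurable_AE_eq:
  fixes f g :: "'a \<Rightarrow> 'b::topological_space"
  assumes "g \<in> borel_measurable M" and "AE x in M. f x = g x"
  shows "f \<in> borel_measurable M"
proof (rule borel_measurableI)
  fix S :: "'b set" assume "open S"
  then have "g -` S \<inter> space M \<in> sets M"
    using assms(1) by (simp add: measurable_sets)
  moreover have "AE x in M. x \<in> g -` S \<inter> space M \<longleftrightarrow> x \<in> f -` S \<inter> space M"
    using assms(2) AE_space by eventually_elim auto
  ultimately show "f -` S \<inter> space M \<in> sets M"
    using in_sets_AE by blast
qed

lemma (in complete_measure) borel_measurable_AE_lim:
  fixes f :: "'a \<Rightarrow> real"
  assumes "\<And>n. g n \<in> borel_measurable M" and "AE x in M. (\<lambda>n. g n x) \<longlonglongrightarrow> f x"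
  shows "f \<in> borel_measurable M"
proof (rule borel_measurable_AE_eq)
  show "(\<lambda>x. lim (\<lambda>n. g n x)) \<in> borel_measurable M"
    using assms(1) by (rule borel_measurable_lim_metric)
  show "AE x in M. f x = lim (\<lambda>n. g n x)"
    using assms(2) by eventually_elim (simp add: limI)
qed

lemma (in complete_measure) borel_measurable_norm_bochner_measurable:
  assumes "bochner_measurable M F"
  shows "(\<lambda>\<omega>. norm (F \<omega>)) \<in> borel_measurable M"
proof -
  obtain s where s: "\<And>n. simple_fun_X M (s n)" "AE \<omega> in M. (\<lambda>n. s n \<omega>) \<longlonglongrightarrow> F \<omega>"
    using assms unfolding bochner_measurable_def by blast
  show ?thesis
  proof (rule borel_measurable_AE_lim)
    show "(\<lambda>\<omega>. norm (s n \<omega>)) \<in> borel_measurable M" for n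
      using borel_measurable_simple_fun_X[OF s(1)] by measurable
    show "AE \<omega> in M. (\<lambda>n. norm (s n \<omega>)) \<longlonglongrightarrow> norm (F \<omega>)"
      using s(2) by eventually_elim (rule tendsto_norm)
  qed
qed

section \<open>Wide slices of the unit ball of a normed space\<close>

definition all_slices_wide ::
  "real \<Rightarrow> ('v \<Rightarrow> 'v \<Rightarrow> 'v) \<Rightarrow> (real \<Rightarrow> 'v \<Rightarrow> 'v) \<Rightarrow> 'v set \<Rightarrow> ('v \<Rightarrow> real) \<Rightarrow> bool" where
  "all_slices_wide \<epsilon> add sc S p \<longleftrightarrow>
     (\<forall>\<phi> \<alpha>. is_dual_functional add sc S p \<phi> \<and> dual_norm_sn S p \<phi> = 1 \<and> \<alpha> > 0 \<longrightarrow>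
        \<epsilon> \<le> diam_sn add sc p (slice_sn (unit_ball_sn S p) \<phi> \<alpha>))"

lemma not_BDP_sn_iff: "\<not> BDP_sn add sc S p \<longleftrightarrow> (\<exists>\<epsilon>>0. all_slices_wide \<epsilon> add sc S p)"
  unfolding BDP_sn_def all_slices_wide_def by (meson not_less)

lemma slice_sn_nonempty:
  fixes \<phi> :: "'v \<Rightarrow> real"
  assumes "C \<noteq> {}" "bdd_above (\<phi> ` C)" "0 < \<alpha>"
  shows "slice_sn C \<phi> \<alpha> \<noteq> {}"
proof -
  have "Sup (\<phi> ` C) - \<alpha> < Sup (\<phi> ` C)"
    using assms(3) by simp
  then obtain x where "x \<in> C" "Sup (\<phi> ` C) - \<alpha> < \<phi> x"
    using less_cSup_iff[of "\<phi> ` C"] assms(1,2) by auto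
  then show ?thesis
    unfolding slice_sn_def by blast
qed

lemma le_diam_sn:
  assumes "\<forall>x\<in>A. \<forall>y\<in>A. p (add x (sc (-1) y)) \<le> b" "x \<in> A" "y \<in> A"
  shows "p (add x (sc (-1) y)) \<le> diam_sn add sc p A"
  unfolding diam_sn_def
proof (rule cSup_upper)
  show "bdd_above {p (add x (sc (-1) y)) | x y. x \<in> A \<and> y \<in> A}"
    using assms(1) by (intro bdd_aboveI[of _ b]) blast
qed (use assms(2,3) in blast)

lemma diam_sn_witness:
  assumes "\<forall>x\<in>A. \<forall>y\<in>A. p (add x (sc (-1) y)) \<le> b" "A \<noteq> {}" "e < diam_sn add sc p A"
  shows "\<exists>x\<in>A. \<exists>y\<in>A. e < p (add x (sc (-1) y))"
proof -
  let ?D = "{p (add x (sc (-1) y)) | x y. x \<in> A \<and> y \<in> A}"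
  have "bdd_above ?D"
    using assms(1) by (intro bdd_aboveI[of _ b]) blast
  moreover have "?D \<noteq> {}"
    using assms(2) by blast
  ultimately obtain t where "t \<in> ?D" "e < t"
    using assms(3) less_cSup_iff[of ?D e] unfolding diam_sn_def by blast
  then show ?thesis
    by blast
qed

lemma unit_ball_sn_UNIV_norm [simp]: "unit_ball_sn UNIV norm = {x. norm x \<le> 1}"
  by (simp add: unit_ball_sn_def)

lemma dual_functional_scaleR:
  assumes "is_dual_functional (+) (*\<^sub>R) (UNIV :: 'x::real_normed_vector set) norm \<psi>"
  shows "\<psi> (a *\<^sub>R x) = a * \<psi> x"
proof -
  have "\<psi> (a *\<^sub>R x + 0 *\<^sub>R x) = a * \<psi> x + 0 * \<psi> x"
    using assms unfolding is_dual_functional_def by blast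
  then show ?thesis
    by simp
qed

lemma dual_functional_bounded_on_ball:
  assumes "is_dual_functional (+) (*\<^sub>R) (UNIV :: 'x::real_normed_vector set) norm \<psi>"
  obtains K where "\<And>x. norm x \<le> 1 \<Longrightarrow> \<bar>\<psi> x\<bar> \<le> K"
proof -
  obtain C where C: "\<And>x. \<bar>\<psi> x\<bar> \<le> C * norm x"
    using assms unfolding is_dual_functional_def by blast
  have "\<bar>\<psi> x\<bar> \<le> \<bar>C\<bar>" if "norm x \<le> 1" for x
  proof -
    have "C * norm x \<le> \<bar>C\<bar> * norm x"
      by (simp add: mult_right_mono)
    also have "\<dots> \<le> \<bar>C\<bar>"
      using that by (simp add: mult_left_le)
    finally show ?thesis
      using C[of x] by linarith
  qed
  then show thesis
    using that by blast
qed

lemma Sup_image_divide: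
  fixes S :: "real set"
  assumes "0 < d" "S \<noteq> {}" "bdd_above S"
  shows "(SUP t\<in>S. t / d) = Sup S / d"
  using assms
  by (intro continuous_at_Sup_mono[symmetric]) (auto simp: mono_def divide_right_mono intro: continuous_intros)

lemma slice_sn_divide:
  fixes \<psi> :: "'v \<Rightarrow> real"
  assumes "0 < d" "C \<noteq> {}" "bdd_above (\<psi> ` C)"
  shows "slice_sn C (\<lambda>x. \<psi> x / d) (\<beta> / d) = slice_sn C \<psi> \<beta>"
proof -
  have "Sup ((\<lambda>x. \<psi> x / d) ` C) = Sup (\<psi> ` C) / d"
    using Sup_image_divide[of d "\<psi> ` C"] assms by (simp add: image_image)
  then show ?thesis
    using assms(1) by (auto simp: slice_sn_def diff_divide_distrib[symmetric] divide_less_cancel)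
qed

lemma all_slices_wide_dual_functional:
  fixes \<psi> :: "'x::real_normed_vector \<Rightarrow> real"
  assumes wide: "all_slices_wide \<epsilon> (+) (*\<^sub>R) (UNIV :: 'x set) norm"
    and \<psi>: "is_dual_functional (+) (*\<^sub>R) UNIV norm \<psi>"
    and d: "0 < dual_norm_sn UNIV norm \<psi>" and "0 < \<beta>"
  shows "\<epsilon> \<le> diam_sn (+) (*\<^sub>R) norm (slice_sn {x. norm x \<le> 1} \<psi> \<beta>)"
proof -
  define d where "d = dual_norm_sn UNIV norm \<psi>"
  define \<psi>' where "\<psi>' x = \<psi> x / d" for x
  obtain C where C: "\<And>x. \<bar>\<psi> x\<bar> \<le> C * norm x"
    using \<psi> unfolding is_dual_functional_def by blast
  have \<psi>'_dual: "is_dual_functional (+) (*\<^sub>R) UNIV norm \<psi>'"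
    unfolding is_dual_functional_def
  proof (intro conjI ballI allI exI)
    show "\<psi>' (a *\<^sub>R x + b *\<^sub>R y) = a * \<psi>' x + b * \<psi>' y" for a b x y
      using \<psi> unfolding is_dual_functional_def \<psi>'_def by (simp add: add_divide_distrib)
    show "\<bar>\<psi>' x\<bar> \<le> C / d * norm x" for x
      using C[of x] d unfolding \<psi>'_def d_def by (simp add: divide_right_mono)
  qed
  obtain K where K: "\<And>x. norm x \<le> 1 \<Longrightarrow> \<bar>\<psi> x\<bar> \<le> K"
    using dual_functional_bounded_on_ball[OF \<psi>] by blast
  let ?S = "(\<lambda>x. \<bar>\<psi> x\<bar>) ` {x. norm x \<le> 1}"
  have S: "?S \<noteq> {}" "bdd_above ?S"
    using K by (auto intro: bdd_aboveI[of _ K] exI[of _ 0])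
  have "dual_norm_sn UNIV norm \<psi>' = (SUP t\<in>?S. t / d)"
    using d unfolding dual_norm_sn_def \<psi>'_def d_def by (simp add: image_image)
  also have "\<dots> = 1"
    using Sup_image_divide[OF _ S] d by (simp add: d_def dual_norm_sn_def)
  finally have "\<epsilon> \<le> diam_sn (+) (*\<^sub>R) norm (slice_sn {x. norm x \<le> 1} \<psi>' (\<beta> / d))"
    using wide \<psi>'_dual d \<open>0 < \<beta>\<close> unfolding all_slices_wide_def d_def by simp
  moreover have "slice_sn {x. norm x \<le> 1} \<psi>' (\<beta> / d) = slice_sn {x. norm x \<le> 1} \<psi> \<beta>"
    unfolding \<psi>'_def
  proof (rule slice_sn_divide)
    show "{x :: 'x. norm x \<le> 1} \<noteq> {}"
      using norm_zero by (metis empty_iff mem_Collect_eq zero_less_one_class.zero_le_one)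
    show "bdd_above (\<psi> ` {x. norm x \<le> 1})"
      using K by (intro bdd_aboveI[of _ K]) (auto dest: abs_le_D1)
  qed (use d in \<open>simp add: d_def\<close>)
  ultimately show ?thesis
    by simp
qed

lemma wide_slices_far_points:
  fixes \<psi> :: "'x::real_normed_vector \<Rightarrow> real"
  assumes wide: "all_slices_wide \<epsilon> (+) (*\<^sub>R) (UNIV :: 'x set) norm"
    and \<psi>: "is_dual_functional (+) (*\<^sub>R) UNIV norm \<psi>"
    and u: "norm u = 1" and "0 < \<epsilon>" "0 < \<delta>"
  shows "\<exists>y z. norm y \<le> 1 \<and> norm z \<le> 1 \<and> min (\<epsilon>/2) 2 \<le> norm (y - z) \<and>
    \<psi> u - \<delta> \<le> \<psi> y \<and> \<psi> u - \<delta> \<le> \<psi> z"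
proof -
  obtain K where K: "\<And>x. norm x \<le> 1 \<Longrightarrow> \<bar>\<psi> x\<bar> \<le> K"
    using dual_functional_bounded_on_ball[OF \<psi>] by blast
  have abs_le: "\<bar>\<psi> x\<bar> \<le> dual_norm_sn UNIV norm \<psi>" if "norm x \<le> 1" for x
    unfolding dual_norm_sn_def
    by (rule cSup_upper) (use K that in \<open>auto intro: bdd_aboveI[of _ K]\<close>)
  show ?thesis
  proof (cases "dual_norm_sn UNIV norm \<psi> = 0")
    case True
    then have "\<psi> u = 0" "\<psi> (-u) = 0"
      using abs_le[of u] abs_le[of "-u"] u by auto
    moreover have "norm (u - -u) = 2"
      using u norm_scaleR[of 2 u] by (simp add: scaleR_2)
    ultimately show ?thesis
      using u \<open>0 < \<delta>\<close> by (intro exI[of _ u] exI[of _ "-u"]) auto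
  next
    case False
    then have "0 < dual_norm_sn UNIV norm \<psi>"
      using abs_le[of 0] by simp
    define T where "T = slice_sn {x. norm x \<le> 1} \<psi> \<delta>"
    have T_ball: "norm x \<le> 1" if "x \<in> T" for x
      using that unfolding T_def slice_sn_def by blast
    have T_dist: "\<forall>x\<in>T. \<forall>y\<in>T. norm (x + (-1) *\<^sub>R y) \<le> 2"
    proof (intro ballI)
      fix x y assume "x \<in> T" "y \<in> T"
      then have "norm (x - y) \<le> 2"
        using T_ball[of x] T_ball[of y] norm_triangle_ineq4[of x y] by linarith
      then show "norm (x + (-1) *\<^sub>R y) \<le> 2"
        by simp
    qed
    have bdd: "bdd_above (\<psi> ` {x. norm x \<le> 1})"
      using K by (intro bdd_aboveI[of _ K]) (auto dest: abs_le_D1)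
    have "T \<noteq> {}"
      unfolding T_def using \<open>0 < \<delta>\<close> by (intro slice_sn_nonempty bdd) (auto intro: exI[of _ 0])
    moreover have "\<epsilon> \<le> diam_sn (+) (*\<^sub>R) norm T"
      unfolding T_def by (rule all_slices_wide_dual_functional[OF wide \<psi> \<open>0 < dual_norm_sn UNIV norm \<psi>\<close> \<open>0 < \<delta>\<close>])
    ultimately obtain y z where yz: "y \<in> T" "z \<in> T" "\<epsilon> / 2 < norm (y + (-1) *\<^sub>R z)"
      using diam_sn_witness[where p = norm and add = "(+)" and sc = "(*\<^sub>R)", OF T_dist, of "\<epsilon> / 2"]
        \<open>0 < \<epsilon>\<close> by auto
    have "\<psi> u \<le> Sup (\<psi> ` {x. norm x \<le> 1})"
      using u by (intro cSup_upper bdd) auto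
    then have near: "\<psi> u - \<delta> \<le> \<psi> w" if "w \<in> T" for w
      using that unfolding T_def slice_sn_def by auto
    show ?thesis
      using yz T_ball near by (intro exI[of _ y] exI[of _ z]) auto
  qed
qed

lemma wide_slices_far_points_scaled:
  fixes \<psi> :: "'x::real_normed_vector \<Rightarrow> real"
  assumes wide: "all_slices_wide \<epsilon> (+) (*\<^sub>R) (UNIV :: 'x set) norm"
    and \<psi>: "is_dual_functional (+) (*\<^sub>R) UNIV norm \<psi>" and "0 < \<epsilon>" "0 < \<delta>"
  shows "\<exists>y z. norm y \<le> norm v \<and> norm z \<le> norm v \<and> min (\<epsilon>/2) 2 * norm v \<le> norm (y - z) \<and>
    \<psi> v - \<delta> \<le> \<psi> y \<and> \<psi> v - \<delta> \<le> \<psi> z"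
proof (cases "v = 0")
  case True
  then show ?thesis
    using \<open>0 < \<delta>\<close> by (intro exI[of _ 0]) simp
next
  case False
  define u where "u = (1 / norm v) *\<^sub>R v"
  have "norm u = 1"
    using False by (simp add: u_def)
  then obtain y z where yz: "norm y \<le> 1" "norm z \<le> 1" "min (\<epsilon>/2) 2 \<le> norm (y - z)"
    "\<psi> u - \<delta> / norm v \<le> \<psi> y" "\<psi> u - \<delta> / norm v \<le> \<psi> z"
    using wide_slices_far_points[OF wide \<psi> _ \<open>0 < \<epsilon>\<close>, of u "\<delta> / norm v"] \<open>0 < \<delta>\<close> False by auto
  have v: "v = norm v *\<^sub>R u"
    using False by (simp add: u_def)
  have scale: "\<psi> (norm v *\<^sub>R w) = norm v * \<psi> w" for w
    by (rule dual_functional_scaleR[OF \<psi>])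
  have near: "\<psi> v - \<delta> \<le> \<psi> (norm v *\<^sub>R w)" if "\<psi> u - \<delta> / norm v \<le> \<psi> w" for w
  proof -
    have "norm v * (\<psi> u - \<delta> / norm v) \<le> norm v * \<psi> w"
      using that by (simp add: mult_left_mono)
    then show ?thesis
      using False by (subst v, simp only: scale) (simp add: right_diff_distrib)
  qed
  have "min (\<epsilon>/2) 2 * norm v \<le> norm v * norm (y - z)"
    using yz(3) by (simp add: mult.commute mult_left_mono)
  then show ?thesis
    using yz near by (intro exI[of _ "norm v *\<^sub>R y"] exI[of _ "norm v *\<^sub>R z"])
      (auto simp: mult_left_le scaleR_diff_right[symmetric])
qed

section \<open>Koethe-Bochner spaces\<close>

locale kothe_bochner_space =
  fixes M :: "'a measure" and E :: "('a \<Rightarrow> real) set" and N :: "('a \<Rightarrow> real) \<Rightarrow> real"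
  assumes complete: "complete_measure M"
    and E_zero: "(\<lambda>_. 0) \<in> E"
    and E_add: "\<And>f g. f \<in> E \<Longrightarrow> g \<in> E \<Longrightarrow> (\<lambda>x. f x + g x) \<in> E"
    and E_scale: "\<And>f c. f \<in> E \<Longrightarrow> (\<lambda>x. c * f x) \<in> E"
    and N_nonneg: "\<And>f. f \<in> E \<Longrightarrow> 0 \<le> N f"
    and N_add: "\<And>f g. f \<in> E \<Longrightarrow> g \<in> E \<Longrightarrow> N (\<lambda>x. f x + g x) \<le> N f + N g"
    and N_scale: "\<And>f c. f \<in> E \<Longrightarrow> N (\<lambda>x. c * f x) = \<bar>c\<bar> * N f"
    and E_indicator: "\<And>A. A \<in> sets M \<Longrightarrow> emeasure M A < \<infinity> \<Longrightarrow> indicator A \<in> E"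
    and E_ideal: "\<And>f g. f \<in> E \<Longrightarrow> g \<in> borel_measurable M \<Longrightarrow> (AE x in M. \<bar>g x\<bar> \<le> \<bar>f x\<bar>) \<Longrightarrow>
      g \<in> E \<and> N g \<le> N f"

lemma kothe_bochner_spaceI:
  assumes "complete_measure M" "kothe_space M E N"
  shows "kothe_bochner_space M E N"
  using assms(2) unfolding kothe_space_def
  by (elim conjE, intro kothe_bochner_space.intro[OF assms(1)]) simp_all

context kothe_bochner_space
begin

abbreviation KB :: "('a \<Rightarrow> 'x::real_normed_vector) set" where
  "KB \<equiv> kothe_bochner M E"

lemma kothe_bochnerD:
  assumes "F \<in> KB"
  shows "bochner_measurable M F" and "(\<lambda>\<omega>. norm (F \<omega>)) \<in> E"
  using assms unfolding kothe_bochner_def by auto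

lemma kb_norm_nonneg: "F \<in> KB \<Longrightarrow> 0 \<le> kb_norm N F"
  unfolding kb_norm_def by (rule N_nonneg) (rule kothe_bochnerD)

lemma kb_norm_scaleR: "F \<in> KB \<Longrightarrow> kb_norm N (\<lambda>\<omega>. c *\<^sub>R F \<omega>) = \<bar>c\<bar> * kb_norm N F"
  using N_scale[OF kothe_bochnerD(2), of F "\<bar>c\<bar>"] by (simp add: kb_norm_def)

lemma kb_norm_zero: "kb_norm N (\<lambda>_. 0 :: 'x::real_normed_vector) = 0"
  using N_scale[OF E_zero, of 0] by (simp add: kb_norm_def)

lemma kothe_bochner_dominated:
  assumes "bochner_measurable M F" "f \<in> E" "\<And>\<omega>. norm (F \<omega>) \<le> f \<omega>"
  shows "F \<in> KB" and "kb_norm N F \<le> N f"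
proof -
  have "(\<lambda>\<omega>. norm (F \<omega>)) \<in> borel_measurable M"
    using complete_measure.borel_measurable_norm_bochner_measurable[OF complete assms(1)] .
  moreover have "AE \<omega> in M. \<bar>norm (F \<omega>)\<bar> \<le> \<bar>f \<omega>\<bar>"
    using assms(3) by (auto intro!: AE_I2 order.trans[OF _ abs_ge_self])
  ultimately have "(\<lambda>\<omega>. norm (F \<omega>)) \<in> E \<and> N (\<lambda>\<omega>. norm (F \<omega>)) \<le> N f"
    using E_ideal[OF assms(2)] by blast
  then show "F \<in> KB" and "kb_norm N F \<le> N f"
    using assms(1) by (auto simp: kothe_bochner_def kb_norm_def)
qed

lemma zero_in_kothe_bochner: "(\<lambda>_. 0) \<in> KB"
  using E_zero bochner_measurable_simple_fun_X[OF simple_fun_X_zero]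
  by (simp add: kothe_bochner_def)

lemma add_scaleR_in_kothe_bochner:
  assumes "F \<in> KB" "G \<in> KB"
  shows "(\<lambda>\<omega>. F \<omega> + c *\<^sub>R G \<omega>) \<in> KB"
    and "kb_norm N (\<lambda>\<omega>. F \<omega> + c *\<^sub>R G \<omega>) \<le> kb_norm N F + \<bar>c\<bar> * kb_norm N G"
proof -
  let ?f = "\<lambda>\<omega>. norm (F \<omega>) + \<bar>c\<bar> * norm (G \<omega>)"
  have G': "(\<lambda>\<omega>. \<bar>c\<bar> * norm (G \<omega>)) \<in> E"
    using E_scale[OF kothe_bochnerD(2)[OF assms(2)]] .
  have f: "?f \<in> E"
    using E_add[OF kothe_bochnerD(2)[OF assms(1)] G'] .
  have bm: "bochner_measurable M (\<lambda>\<omega>. F \<omega> + c *\<^sub>R G \<omega>)"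
    using bochner_measurable_add_scaleR[OF kothe_bochnerD(1)[OF assms(1)] kothe_bochnerD(1)[OF assms(2)]] .
  have le: "norm (F \<omega> + c *\<^sub>R G \<omega>) \<le> ?f \<omega>" for \<omega>
    using norm_triangle_ineq[of "F \<omega>" "c *\<^sub>R G \<omega>"] by simp
  show "(\<lambda>\<omega>. F \<omega> + c *\<^sub>R G \<omega>) \<in> KB"
    using kothe_bochner_dominated(1)[OF bm f le] .
  have "N ?f \<le> kb_norm N F + \<bar>c\<bar> * kb_norm N G"
    using N_add[OF kothe_bochnerD(2)[OF assms(1)] G'] N_scale[OF kothe_bochnerD(2)[OF assms(2)], of "\<bar>c\<bar>"]
    by (simp add: kb_norm_def)
  then show "kb_norm N (\<lambda>\<omega>. F \<omega> + c *\<^sub>R G \<omega>) \<le> kb_norm N F + \<bar>c\<bar> * kb_norm N G"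
    using kothe_bochner_dominated(2)[OF bm f le] by linarith
qed

lemma scaleR_in_kothe_bochner: "F \<in> KB \<Longrightarrow> (\<lambda>\<omega>. c *\<^sub>R F \<omega>) \<in> KB"
  using add_scaleR_in_kothe_bochner(1)[OF zero_in_kothe_bochner] by simp

lemma kb_norm_mono:
  assumes "F \<in> KB" "G \<in> KB" "\<And>\<omega>. norm (F \<omega>) \<le> norm (G \<omega>)"
  shows "kb_norm N F \<le> kb_norm N G"
  using kothe_bochner_dominated(2)[OF kothe_bochnerD(1)[OF assms(1)] kothe_bochnerD(2)[OF assms(2)] assms(3)]
  by (simp add: kb_norm_def)

lemma indicator_scaleR_in_kothe_bochner:
  assumes "A \<in> sets M" "emeasure M A < \<infinity>"
  shows "(\<lambda>\<omega>. indicator A \<omega> *\<^sub>R x) \<in> KB"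
    and "kb_norm N (\<lambda>\<omega>. indicator A \<omega> *\<^sub>R x) = norm x * N (indicator A)"
proof -
  have norm_eq: "(\<lambda>\<omega>. norm (indicator A \<omega> *\<^sub>R x)) = (\<lambda>\<omega>. norm x * indicator A \<omega>)"
    by (auto simp: indicator_def)
  show "(\<lambda>\<omega>. indicator A \<omega> *\<^sub>R x) \<in> KB"
    using bochner_measurable_simple_fun_X[OF simple_fun_X_indicator_scaleR[OF assms]]
      E_scale[OF E_indicator[OF assms]]
    unfolding kothe_bochner_def mem_Collect_eq norm_eq by blast
  show "kb_norm N (\<lambda>\<omega>. indicator A \<omega> *\<^sub>R x) = norm x * N (indicator A)"
    unfolding kb_norm_def norm_eq using N_scale[OF E_indicator[OF assms], of "norm x"]
    by (simp only: abs_norm_cancel)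
qed

end

section \<open>Slices of the unit ball of a Koethe-Bochner space\<close>

locale kothe_bochner_functional = kothe_bochner_space M E N
  for M :: "'a measure" and E N +
  fixes \<phi> :: "('a \<Rightarrow> 'x::real_normed_vector) \<Rightarrow> real"
  assumes dual: "is_dual_functional fun_add fun_scale (kothe_bochner M E) (kb_norm N) \<phi>"
    and dual_norm_1: "dual_norm_sn (kothe_bochner M E) (kb_norm N) \<phi> = 1"
begin

abbreviation B :: "('a \<Rightarrow> 'x) set" where
  "B \<equiv> unit_ball_sn KB (kb_norm N)"

lemma mem_B: "F \<in> B \<longleftrightarrow> F \<in> KB \<and> kb_norm N F \<le> 1"
  by (simp add: unit_ball_sn_def)

lemma zero_in_B: "(\<lambda>_. 0) \<in> B"
  by (simp add: mem_B zero_in_kothe_bochner kb_norm_zero)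

lemma phi_add_scaleR:
  assumes "F \<in> KB" "G \<in> KB"
  shows "\<phi> (\<lambda>\<omega>. F \<omega> + c *\<^sub>R G \<omega>) = \<phi> F + c * \<phi> G"
proof -
  have "\<phi> (fun_add (fun_scale 1 F) (fun_scale c G)) = 1 * \<phi> F + c * \<phi> G"
    using dual assms unfolding is_dual_functional_def by blast
  then show ?thesis
    by (simp add: fun_add_def fun_scale_def)
qed

lemma phi_zero: "\<phi> (\<lambda>_. 0) = 0"
  using phi_add_scaleR[OF zero_in_kothe_bochner zero_in_kothe_bochner, of 1] by simp

lemma phi_scaleR: "F \<in> KB \<Longrightarrow> \<phi> (\<lambda>\<omega>. c *\<^sub>R F \<omega>) = c * \<phi> F"
  using phi_add_scaleR[OF zero_in_kothe_bochner, of F c] by (simp add: phi_zero)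

lemma phi_bounded: "\<exists>C\<ge>0. \<forall>F\<in>KB. \<bar>\<phi> F\<bar> \<le> C * kb_norm N F"
proof -
  obtain C where C: "\<forall>F\<in>KB. \<bar>\<phi> F\<bar> \<le> C * kb_norm N F"
    using dual unfolding is_dual_functional_def by blast
  have "\<bar>\<phi> F\<bar> \<le> max C 0 * kb_norm N F" if "F \<in> KB" for F
  proof -
    have "C * kb_norm N F \<le> max C 0 * kb_norm N F"
      using kb_norm_nonneg[OF that] by (intro mult_right_mono) auto
    then show ?thesis
      using C that by fastforce
  qed
  then show ?thesis
    by (intro exI[of _ "max C 0"]) auto
qed

lemma abs_phi_le_1:
  assumes F: "F \<in> B"
  shows "\<bar>\<phi> F\<bar> \<le> 1"
proof -
  obtain C where C: "0 \<le> C" "\<forall>F\<in>KB. \<bar>\<phi> F\<bar> \<le> C * kb_norm N F"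
    using phi_bounded by blast
  have "\<bar>\<phi> G\<bar> \<le> C" if "G \<in> B" for G
  proof -
    have "G \<in> KB" "kb_norm N G \<le> 1"
      using that by (simp_all add: mem_B)
    then have "\<bar>\<phi> G\<bar> \<le> C * kb_norm N G"
      using C(2) by blast
    also have "\<dots> \<le> C"
      using \<open>kb_norm N G \<le> 1\<close> C(1) by (simp add: mult_left_le)
    finally show ?thesis .
  qed
  then have "bdd_above ((\<lambda>F. \<bar>\<phi> F\<bar>) ` B)"
    by (intro bdd_aboveI[of _ C]) auto
  then have "\<bar>\<phi> F\<bar> \<le> Sup ((\<lambda>F. \<bar>\<phi> F\<bar>) ` B)"
    using F by (intro cSup_upper) auto
  then show ?thesis
    using dual_norm_1 by (simp add: dual_norm_sn_def)
qed

lemma bdd_above_phi: "bdd_above (\<phi> ` B)"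
proof (rule bdd_aboveI[of _ 1])
  show "t \<le> 1" if "t \<in> \<phi> ` B" for t
    using that abs_phi_le_1 by (auto dest: abs_le_D1)
qed

lemma one_le_Sup_phi: "1 \<le> Sup (\<phi> ` B)"
proof -
  have "\<bar>\<phi> F\<bar> \<le> Sup (\<phi> ` B)" if F: "F \<in> B" for F
  proof -
    have "(\<lambda>\<omega>. (-1) *\<^sub>R F \<omega>) \<in> B"
      using F scaleR_in_kothe_bochner[of F "-1"] kb_norm_scaleR[of F "-1"] by (simp add: mem_B)
    then have "\<phi> (\<lambda>\<omega>. (-1) *\<^sub>R F \<omega>) \<le> Sup (\<phi> ` B)"
      using bdd_above_phi by (intro cSup_upper) auto
    moreover have "\<phi> F \<le> Sup (\<phi> ` B)"
      using F bdd_above_phi by (intro cSup_upper) auto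
    moreover have "\<phi> (\<lambda>\<omega>. (-1) *\<^sub>R F \<omega>) = - \<phi> F"
      using F phi_scaleR[of F "-1"] by (simp add: mem_B)
    ultimately show ?thesis
      by linarith
  qed
  then have "Sup ((\<lambda>F. \<bar>\<phi> F\<bar>) ` B) \<le> Sup (\<phi> ` B)"
    using zero_in_B by (intro cSup_least) auto
  then show ?thesis
    using dual_norm_1 by (simp add: dual_norm_sn_def)
qed

lemma phi_le_kb_norm:
  assumes F: "F \<in> KB"
  shows "\<phi> F \<le> kb_norm N F"
proof (cases "kb_norm N F = 0")
  case True
  obtain C where "\<forall>F\<in>KB. \<bar>\<phi> F\<bar> \<le> C * kb_norm N F"
    using phi_bounded by blast
  then have "\<bar>\<phi> F\<bar> \<le> 0"
    using F True by force
  then show ?thesis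
    using True by simp
next
  case False
  then have pos: "0 < kb_norm N F"
    using kb_norm_nonneg[OF F] by simp
  have "(\<lambda>\<omega>. (1 / kb_norm N F) *\<^sub>R F \<omega>) \<in> B"
    using F pos scaleR_in_kothe_bochner[of F] kb_norm_scaleR[of F] by (simp add: mem_B)
  then have "\<phi> (\<lambda>\<omega>. (1 / kb_norm N F) *\<^sub>R F \<omega>) \<le> 1"
    using abs_phi_le_1 abs_le_D1 by blast
  then have "\<phi> F / kb_norm N F \<le> 1"
    using phi_scaleR[OF F] by simp
  then show ?thesis
    using pos by (simp add: divide_le_eq)
qed

lemma phi_sum_indicator_scaleR:
  fixes n :: nat
  assumes "\<forall>i<n. A i \<in> sets M \<and> emeasure M (A i) < \<infinity>"
  shows "(\<lambda>\<omega>. \<Sum>i<n. indicator (A i) \<omega> *\<^sub>R x i) \<in> KB \<and>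
    \<phi> (\<lambda>\<omega>. \<Sum>i<n. indicator (A i) \<omega> *\<^sub>R x i) = (\<Sum>i<n. \<phi> (\<lambda>\<omega>. indicator (A i) \<omega> *\<^sub>R x i))"
  using assms
proof (induction n)
  case 0
  show ?case
    using zero_in_kothe_bochner phi_zero by simp
next
  case (Suc n)
  then have IH: "(\<lambda>\<omega>. \<Sum>i<n. indicator (A i) \<omega> *\<^sub>R x i) \<in> KB"
    "\<phi> (\<lambda>\<omega>. \<Sum>i<n. indicator (A i) \<omega> *\<^sub>R x i) = (\<Sum>i<n. \<phi> (\<lambda>\<omega>. indicator (A i) \<omega> *\<^sub>R x i))"
    by simp_all
  have last: "(\<lambda>\<omega>. indicator (A n) \<omega> *\<^sub>R x n) \<in> KB"
    using Suc.prems indicator_scaleR_in_kothe_bochner(1) by blast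
  have split: "(\<lambda>\<omega>. \<Sum>i<Suc n. indicator (A i) \<omega> *\<^sub>R x i) =
      (\<lambda>\<omega>. (\<Sum>i<n. indicator (A i) \<omega> *\<^sub>R x i) + 1 *\<^sub>R (indicator (A n) \<omega> *\<^sub>R x n))"
    by simp
  show ?case
  proof
    show "(\<lambda>\<omega>. \<Sum>i<Suc n. indicator (A i) \<omega> *\<^sub>R x i) \<in> KB"
      unfolding split by (rule add_scaleR_in_kothe_bochner(1)[OF IH(1) last])
    show "\<phi> (\<lambda>\<omega>. \<Sum>i<Suc n. indicator (A i) \<omega> *\<^sub>R x i) = (\<Sum>i<Suc n. \<phi> (\<lambda>\<omega>. indicator (A i) \<omega> *\<^sub>R x i))"
      unfolding split phi_add_scaleR[OF IH(1) last] IH(2) by simp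
  qed
qed

lemma dual_functional_indicator:
  assumes A: "A \<in> sets M" "emeasure M A < \<infinity>"
  shows "is_dual_functional (+) (*\<^sub>R) (UNIV :: 'x set) norm (\<lambda>x. \<phi> (\<lambda>\<omega>. indicator A \<omega> *\<^sub>R x))"
  unfolding is_dual_functional_def
proof (intro conjI ballI allI)
  fix x y :: 'x and a b :: real
  let ?I = "\<lambda>x \<omega>. indicator A \<omega> *\<^sub>R x"
  have x: "?I x \<in> KB" and y: "?I y \<in> KB"
    using indicator_scaleR_in_kothe_bochner(1)[OF A] by blast+
  have "\<phi> (?I (a *\<^sub>R x + b *\<^sub>R y)) = \<phi> (\<lambda>\<omega>. a *\<^sub>R ?I x \<omega> + b *\<^sub>R ?I y \<omega>)"
    by (rule arg_cong[where f = \<phi>]) (simp add: scaleR_add_right ac_simps)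
  also have "\<dots> = \<phi> (\<lambda>\<omega>. a *\<^sub>R ?I x \<omega>) + b * \<phi> (?I y)"
    using phi_add_scaleR[OF scaleR_in_kothe_bochner[OF x] y] .
  finally show "\<phi> (?I (a *\<^sub>R x + b *\<^sub>R y)) = a * \<phi> (?I x) + b * \<phi> (?I y)"
    using phi_scaleR[OF x] by simp
next
  obtain C where C: "\<forall>F\<in>KB. \<bar>\<phi> F\<bar> \<le> C * kb_norm N F"
    using phi_bounded by blast
  show "\<exists>K. \<forall>x\<in>UNIV. \<bar>\<phi> (\<lambda>\<omega>. indicator A \<omega> *\<^sub>R x)\<bar> \<le> K * norm (x :: 'x)"
  proof (intro exI[of _ "C * N (indicator A)"] ballI)
    fix x :: 'x
    have "\<bar>\<phi> (\<lambda>\<omega>. indicator A \<omega> *\<^sub>R x)\<bar> \<le> C * kb_norm N (\<lambda>\<omega>. indicator A \<omega> *\<^sub>R x)"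
      using C indicator_scaleR_in_kothe_bochner(1)[OF A] by blast
    then show "\<bar>\<phi> (\<lambda>\<omega>. indicator A \<omega> *\<^sub>R x)\<bar> \<le> C * N (indicator A) * norm x"
      by (simp add: indicator_scaleR_in_kothe_bochner(2)[OF A] ac_simps)
  qed
qed

lemma exists_simple_near_Sup:
  assumes dense: "simple_dense M E N TYPE('x)" and "0 < a"
  shows "\<exists>s. simple_fun_X M s \<and> s \<in> B \<and> Sup (\<phi> ` B) - a < \<phi> s"
proof -
  obtain C where C: "0 \<le> C" "\<forall>F\<in>KB. \<bar>\<phi> F\<bar> \<le> C * kb_norm N F"
    using phi_bounded by blast
  obtain h where h: "h \<in> B" "Sup (\<phi> ` B) - a / 2 < \<phi> h"
    using slice_sn_nonempty[OF _ bdd_above_phi, of "a / 2"] zero_in_B \<open>0 < a\<close>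
    unfolding slice_sn_def by fastforce
  have h_KB: "h \<in> KB" "kb_norm N h \<le> 1" and "\<phi> h \<le> 1"
    using h(1) abs_phi_le_1[OF h(1)] by (auto simp: mem_B)
  define t where "t = min (1/2) (a / (2 * (C + 1)))"
  have t: "0 < t" "t \<le> 1/2"
    using \<open>0 < a\<close> C(1) unfolding t_def by (simp, linarith)
  have "t * (C + 1) \<le> a / (2 * (C + 1)) * (C + 1)"
    using C(1) by (intro mult_right_mono) (simp_all add: t_def)
  also have "\<dots> = a / 2"
    using C(1) by (simp add: field_simps)
  finally have tC: "t * (C + 1) \<le> a / 2" .
  \<comment> \<open>Shrinking h first leaves room for the approximation error inside the unit ball.\<close>
  define h' where "h' = (\<lambda>\<omega>. (1 - t) *\<^sub>R h \<omega>)"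
  have h': "h' \<in> KB" "kb_norm N h' \<le> 1 - t" "\<phi> h' = (1 - t) * \<phi> h"
    using h_KB t scaleR_in_kothe_bochner kb_norm_scaleR[of h "1 - t"] phi_scaleR[of h "1 - t"]
    by (auto simp: h'_def mult_left_le)
  obtain s where s: "simple_fun_X M s" "s \<in> KB" "kb_norm N (\<lambda>\<omega>. h' \<omega> - s \<omega>) < t"
    using dense h'(1) t(1) unfolding simple_dense_def by blast
  define r where "r = (\<lambda>\<omega>. h' \<omega> + (-1) *\<^sub>R s \<omega>)"
  have r: "r \<in> KB" "kb_norm N r < t"
    using add_scaleR_in_kothe_bochner(1)[OF h'(1) s(2), of "-1"] s(3) by (simp_all add: r_def)
  have s_eq: "s = (\<lambda>\<omega>. h' \<omega> + (-1) *\<^sub>R r \<omega>)"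
    by (simp add: r_def)
  have "kb_norm N s \<le> kb_norm N h' + kb_norm N r"
    using add_scaleR_in_kothe_bochner(2)[OF h'(1) r(1), of "-1"] s_eq by simp
  then have "s \<in> B"
    using h'(2) r(2) s(2) by (simp add: mem_B)
  have "\<phi> s = \<phi> h' - \<phi> r"
    using phi_add_scaleR[OF h'(1) r(1), of "-1"] s_eq by simp
  moreover have "\<phi> r \<le> C * t"
    using C r mult_left_mono[of "kb_norm N r" t C] by fastforce
  moreover have "t * \<phi> h \<le> t"
    using \<open>\<phi> h \<le> 1\<close> t(1) by (simp add: mult_left_le)
  ultimately have "\<phi> h - t * (C + 1) \<le> \<phi> s"
    using h'(3) by (simp add: algebra_simps)
  then show ?thesis
    using s(1) \<open>s \<in> B\<close> h(2) tC by (intro exI[of _ s]) auto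
qed

lemma sum_indicator_in_slice:
  fixes n :: nat
  assumes A: "\<forall>i<n. A i \<in> sets M \<and> emeasure M (A i) < \<infinity>" and disj: "disjoint_family_on A {..<n}"
    and s: "s = (\<lambda>\<omega>. \<Sum>i<n. indicator (A i) \<omega> *\<^sub>R v i)" "s \<in> B"
    and W: "\<forall>i<n. norm (W i) \<le> norm (v i) \<and>
      \<phi> (\<lambda>\<omega>. indicator (A i) \<omega> *\<^sub>R v i) - \<delta> \<le> \<phi> (\<lambda>\<omega>. indicator (A i) \<omega> *\<^sub>R W i)"
    and gap: "real n * \<delta> < \<phi> s - (Sup (\<phi> ` B) - \<alpha>)"
  shows "(\<lambda>\<omega>. \<Sum>i<n. indicator (A i) \<omega> *\<^sub>R W i) \<in> slice_sn B \<phi> \<alpha>"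
proof -
  let ?F = "\<lambda>\<omega>. \<Sum>i<n. indicator (A i) \<omega> *\<^sub>R W i"
  have F: "?F \<in> KB" "\<phi> ?F = (\<Sum>i<n. \<phi> (\<lambda>\<omega>. indicator (A i) \<omega> *\<^sub>R W i))"
    using phi_sum_indicator_scaleR[OF A] by auto
  have phi_s: "\<phi> s = (\<Sum>i<n. \<phi> (\<lambda>\<omega>. indicator (A i) \<omega> *\<^sub>R v i))"
    using phi_sum_indicator_scaleR[OF A] s(1) by auto
  have "s \<in> KB" "kb_norm N s \<le> 1"
    using s(2) by (simp_all add: mem_B)
  have "norm (?F \<omega>) \<le> norm (s \<omega>)" for \<omega>
    unfolding s(1) using W
    by (intro sum_indicator_scaleR_rel[OF disj finite_lessThan, where R = "\<lambda>a b. norm a \<le> norm b"]) auto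
  then have "kb_norm N ?F \<le> 1"
    using kb_norm_mono[OF F(1) \<open>s \<in> KB\<close>] \<open>kb_norm N s \<le> 1\<close> by fastforce
  moreover have "\<phi> s - real n * \<delta> \<le> \<phi> ?F"
  proof -
    have "(\<Sum>i<n. \<phi> (\<lambda>\<omega>. indicator (A i) \<omega> *\<^sub>R v i) - \<delta>) \<le> \<phi> ?F"
      unfolding F(2) using W by (intro sum_mono) auto
    then show ?thesis
      by (simp add: phi_s sum_subtractf)
  qed
  ultimately show ?thesis
    using F(1) gap by (simp add: slice_sn_def mem_B)
qed

lemma kb_norm_diff_le_diam_slice:
  assumes "F \<in> slice_sn B \<phi> \<alpha>" "G \<in> slice_sn B \<phi> \<alpha>"
  shows "kb_norm N (fun_add F (fun_scale (-1) G)) \<le> diam_sn fun_add fun_scale (kb_norm N) (slice_sn B \<phi> \<alpha>)"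
proof (rule le_diam_sn[OF _ assms])
  show "\<forall>x\<in>slice_sn B \<phi> \<alpha>. \<forall>y\<in>slice_sn B \<phi> \<alpha>. kb_norm N (fun_add x (fun_scale (-1) y)) \<le> 2"
  proof (intro ballI)
    fix x y assume "x \<in> slice_sn B \<phi> \<alpha>" "y \<in> slice_sn B \<phi> \<alpha>"
    then have "x \<in> KB" "y \<in> KB" "kb_norm N x \<le> 1" "kb_norm N y \<le> 1"
      by (auto simp: slice_sn_def mem_B)
    then show "kb_norm N (fun_add x (fun_scale (-1) y)) \<le> 2"
      using add_scaleR_in_kothe_bochner(2)[of x y "-1"] by (simp add: fun_add_def fun_scale_def)
  qed
qed

lemma slice_contains_far_step_functions:
  fixes n :: nat
  assumes wide: "all_slices_wide \<epsilon> (+) (*\<^sub>R) (UNIV :: 'x set) norm" and "0 < \<epsilon>"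
    and A: "\<forall>i<n. A i \<in> sets M \<and> emeasure M (A i) < \<infinity>" and disj: "disjoint_family_on A {..<n}"
    and s: "s = (\<lambda>\<omega>. \<Sum>i<n. indicator (A i) \<omega> *\<^sub>R v i)" "s \<in> B"
    and "0 < \<delta>" and gap: "real n * \<delta> < \<phi> s - (Sup (\<phi> ` B) - \<alpha>)"
  shows "\<exists>F\<in>slice_sn B \<phi> \<alpha>. \<exists>G\<in>slice_sn B \<phi> \<alpha>. \<forall>\<omega>. min (\<epsilon>/2) 2 * norm (s \<omega>) \<le> norm (F \<omega> - G \<omega>)"
proof -
  define c where "c = min (\<epsilon>/2) 2"
  have "\<forall>i<n. \<exists>y z. norm y \<le> norm (v i) \<and> norm z \<le> norm (v i) \<and> c * norm (v i) \<le> norm (y - z) \<and>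
      \<phi> (\<lambda>\<omega>. indicator (A i) \<omega> *\<^sub>R v i) - \<delta> \<le> \<phi> (\<lambda>\<omega>. indicator (A i) \<omega> *\<^sub>R y) \<and>
      \<phi> (\<lambda>\<omega>. indicator (A i) \<omega> *\<^sub>R v i) - \<delta> \<le> \<phi> (\<lambda>\<omega>. indicator (A i) \<omega> *\<^sub>R z)"
    using wide_slices_far_points_scaled[OF wide dual_functional_indicator \<open>0 < \<epsilon>\<close> \<open>0 < \<delta>\<close>] A
    unfolding c_def by blast
  then obtain Y Z where YZ: "\<forall>i<n. norm (Y i) \<le> norm (v i) \<and> norm (Z i) \<le> norm (v i) \<and>
      c * norm (v i) \<le> norm (Y i - Z i) \<and>
      \<phi> (\<lambda>\<omega>. indicator (A i) \<omega> *\<^sub>R v i) - \<delta> \<le> \<phi> (\<lambda>\<omega>. indicator (A i) \<omega> *\<^sub>R Y i) \<and>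
      \<phi> (\<lambda>\<omega>. indicator (A i) \<omega> *\<^sub>R v i) - \<delta> \<le> \<phi> (\<lambda>\<omega>. indicator (A i) \<omega> *\<^sub>R Z i)"
    by metis
  define F where "F = (\<lambda>\<omega>. \<Sum>i<n. indicator (A i) \<omega> *\<^sub>R Y i)"
  define G where "G = (\<lambda>\<omega>. \<Sum>i<n. indicator (A i) \<omega> *\<^sub>R Z i)"
  have "F \<in> slice_sn B \<phi> \<alpha>"
    unfolding F_def by (rule sum_indicator_in_slice[OF A disj s _ gap]) (use YZ in blast)
  moreover have "G \<in> slice_sn B \<phi> \<alpha>"
    unfolding G_def by (rule sum_indicator_in_slice[OF A disj s _ gap]) (use YZ in blast)
  moreover have "c * norm (s \<omega>) \<le> norm (F \<omega> - G \<omega>)" for \<omega>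
  proof -
    have "F \<omega> - G \<omega> = (\<Sum>i<n. indicator (A i) \<omega> *\<^sub>R (Y i - Z i))"
      by (simp add: F_def G_def scaleR_diff_right sum_subtractf)
    then show ?thesis
      unfolding s(1) using YZ
      by (simp only:) (intro sum_indicator_scaleR_rel[OF disj finite_lessThan, where R = "\<lambda>a b. c * norm b \<le> norm a"], auto)
  qed
  ultimately show ?thesis
    unfolding c_def by blast
qed

lemma diam_slice_gt:
  assumes dense: "simple_dense M E N TYPE('x)" and wide: "all_slices_wide \<epsilon> (+) (*\<^sub>R) (UNIV :: 'x set) norm"
    and "0 < \<epsilon>" "0 < \<alpha>"
  shows "min (\<epsilon>/2) 2 / 2 < diam_sn fun_add fun_scale (kb_norm N) (slice_sn B \<phi> \<alpha>)"
proof -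
  define c where "c = min (\<epsilon>/2) 2"
  have "0 < c"
    using \<open>0 < \<epsilon>\<close> by (simp add: c_def)
  obtain s where s: "simple_fun_X M s" "s \<in> B" "Sup (\<phi> ` B) - min \<alpha> (1/2) < \<phi> s"
    using exists_simple_near_Sup[OF dense, of "min \<alpha> (1/2)"] \<open>0 < \<alpha>\<close> by auto
  have "s \<in> KB"
    using s(2) by (simp add: mem_B)
  have "1/2 < kb_norm N s"
    using phi_le_kb_norm[OF \<open>s \<in> KB\<close>] one_le_Sup_phi s(3) by linarith
  obtain n :: nat and A v where A: "\<forall>i<n. A i \<in> sets M \<and> emeasure M (A i) < \<infinity>"
    and disj: "disjoint_family_on A {..<n}" and s_eq: "s = (\<lambda>\<omega>. \<Sum>i<n. indicator (A i) \<omega> *\<^sub>R v i)"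
    using s(1) unfolding simple_fun_X_def by blast
  define \<delta> where "\<delta> = (\<phi> s - (Sup (\<phi> ` B) - \<alpha>)) / (real n + 1)"
  have "0 < \<phi> s - (Sup (\<phi> ` B) - \<alpha>)"
    using s(3) by linarith
  then have "0 < \<delta>" and gap: "real n * \<delta> < \<phi> s - (Sup (\<phi> ` B) - \<alpha>)"
    by (simp_all add: \<delta>_def field_simps)
  obtain F G where FG: "F \<in> slice_sn B \<phi> \<alpha>" "G \<in> slice_sn B \<phi> \<alpha>"
    and far: "\<And>\<omega>. c * norm (s \<omega>) \<le> norm (F \<omega> - G \<omega>)"
    using slice_contains_far_step_functions[OF wide \<open>0 < \<epsilon>\<close> A disj s_eq s(2) \<open>0 < \<delta>\<close> gap]
    unfolding c_def by blast
  define D where "D = fun_add F (fun_scale (-1) G)"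
  have "F \<in> KB" "G \<in> KB"
    using FG by (auto simp: slice_sn_def mem_B)
  then have "D \<in> KB"
    using add_scaleR_in_kothe_bochner(1)[of F G "-1"] by (simp add: D_def fun_add_def fun_scale_def)
  have "norm (c *\<^sub>R s \<omega>) \<le> norm (D \<omega>)" for \<omega>
    using far[of \<omega>] \<open>0 < c\<close> by (simp add: D_def fun_add_def fun_scale_def)
  then have "kb_norm N (\<lambda>\<omega>. c *\<^sub>R s \<omega>) \<le> kb_norm N D"
    by (rule kb_norm_mono[OF scaleR_in_kothe_bochner[OF \<open>s \<in> KB\<close>] \<open>D \<in> KB\<close>])
  then have "c * kb_norm N s \<le> kb_norm N D"
    using kb_norm_scaleR[OF \<open>s \<in> KB\<close>, of c] \<open>0 < c\<close> by simp
  also have "\<dots> \<le> diam_sn fun_add fun_scale (kb_norm N) (slice_sn B \<phi> \<alpha>)"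
    unfolding D_def using kb_norm_diff_le_diam_slice[OF FG] .
  finally have "c * kb_norm N s \<le> diam_sn fun_add fun_scale (kb_norm N) (slice_sn B \<phi> \<alpha>)" .
  moreover have "c / 2 < c * kb_norm N s"
    using mult_strict_left_mono[OF \<open>1/2 < kb_norm N s\<close> \<open>0 < c\<close>] by simp
  ultimately show ?thesis
    unfolding c_def[symmetric] by linarith
qed

end

lemma (in kothe_bochner_space) all_slices_wide_kothe_bochner:
  assumes dense: "simple_dense M E N TYPE('x::real_normed_vector)"
    and wide: "all_slices_wide \<epsilon> (+) (*\<^sub>R) (UNIV :: 'x set) norm" and "0 < \<epsilon>"
  shows "all_slices_wide (min (\<epsilon>/2) 2 / 2) fun_add fun_scale (KB :: ('a \<Rightarrow> 'x) set) (kb_norm N)"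
  unfolding all_slices_wide_def
proof (intro allI impI, elim conjE)
  fix \<phi> :: "('a \<Rightarrow> 'x) \<Rightarrow> real" and \<alpha> :: real
  assume "is_dual_functional fun_add fun_scale KB (kb_norm N) \<phi>" "dual_norm_sn KB (kb_norm N) \<phi> = 1" "0 < \<alpha>"
  then interpret kothe_bochner_functional M E N \<phi>
    by unfold_locales
  show "min (\<epsilon>/2) 2 / 2 \<le> diam_sn fun_add fun_scale (kb_norm N) (slice_sn (unit_ball_sn KB (kb_norm N)) \<phi> \<alpha>)"
    using diam_slice_gt[OF dense wide \<open>0 < \<epsilon>\<close> \<open>0 < \<alpha>\<close>] by simp
qed

theorem mainTheorem5:
  fixes M :: "'a measure" and E :: "('a \<Rightarrow> real) set" and N :: "('a \<Rightarrow> real) \<Rightarrow> real"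
  assumes "complete_measure M" and "sigma_finite_measure M"
    and "kothe_space M E N"
    and "simple_dense M E N TYPE('x::banach)"
    and "BDP_kothe_bochner M E N TYPE('x)"
  shows "BDP TYPE('x)"
proof (rule ccontr)
  assume "\<not> BDP TYPE('x)"
  then obtain \<epsilon> where "0 < \<epsilon>" and wide: "all_slices_wide \<epsilon> (+) (*\<^sub>R) (UNIV :: 'x set) norm"
    unfolding BDP_def not_BDP_sn_iff by blast
  interpret kothe_bochner_space M E N
    using kothe_bochner_spaceI assms(1,3) .
  have "all_slices_wide (min (\<epsilon>/2) 2 / 2) fun_add fun_scale (KB :: ('a \<Rightarrow> 'x) set) (kb_norm N)"
    using all_slices_wide_kothe_bochner[OF assms(4) wide \<open>0 < \<epsilon>\<close>] .
  moreover have "0 < min (\<epsilon>/2) 2 / 2"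
    using \<open>0 < \<epsilon>\<close> by simp
  ultimately have "\<not> BDP_kothe_bochner M E N TYPE('x)"
    unfolding BDP_kothe_bochner_def not_BDP_sn_iff by blast
  then show False
    using assms(5) by contradiction
qed

end
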